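(* Let $m$ be a positive integer, $r>0$, $\mu:=\frac12-r$, $g:\mathbb{R}\to\mathbb{R}$ continuous, $h>0$, and let $\vec y(h)=(y_0(h),\dots,y_m(h))\in\mathbb{R}^{m+1}$ have mutually distinct entries. Let $\mathcal{H}_h$ be the map on real polynomials of degree at most $m$ that sends $p[X]$ to the unique polynomial of degree at most $m$ which agrees with the function $\left(e^{-rh}\,p(\cdot)\ast\nu_{-\mu h,h}\right)\vee g$ at the points $y_0(h),\dots,y_m(h)$. Then a polynomial $q[X]=\sum_{k=0}^mq_kX^k$ is a fixed point of $\mathcal{H}_h$ if and only if there are a natural number $n\in\{0,\dots,m\}$ and a permutation $\sigma$ of $\{0,\dots,m\}$ such that $$A_n^\sigma(h)\cdot{}^t(q_0,\dots,q_m)=\vec v(\vec y,n,h,\sigma)$$ and, in addition, $$\forall j\in\{0,\dots,n\}\quad g(y_{\sigma(j)}(h))\vee e^{-rh}\left(q(\cdot)\ast\nu_{-\mu h,h}\right)(y_{\sigma(j)}(h))=g(y_{\sigma(j)}(h))$$ as well as $$\forall j\in\{n+1,\dots,m\}\quad g(y_{\sigma(j)}(h))\vee e^{-rh}\left(q(\cdot)\ast\nu_{-\mu h,h}\right)(y_{\sigma(j)}(h))=e^{-rh}\left(q(\cdot)\ast\nu_{-\mu h,h}\right)(y_{\sigma(j)}(h)).$$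
   Context: $\nu_{a,b}$ is the Gaussian probability measure on $\mathbb{R}$ with mean $a$ and variance $b$; $p(\cdot)$ is the polynomial function associated with $p[X]$; $(p(\cdot)\ast\nu)(x)=\int p(x-z)\,\nu(dz)$; $\vee$ is the (pointwise) maximum. $A_n^\sigma(h)$ is the $(m+1)\times(m+1)$ matrix, with rows $j$ and columns $k$ indexed by $0,\dots,m$, whose $(j,k)$ entry is $y_{\sigma(j)}(h)^k$ for $j\le n$ and $y_{\sigma(j)}(h)^k-e^{-rh}\left((\cdot)^k\ast\nu_{-\mu h,h}\right)(y_{\sigma(j)}(h))$ for $j\ge n+1$. The vector $\vec v(\vec y,n,h,\sigma)\in\mathbb{R}^{m+1}$ has $j$-th entry $g(y_{\sigma(j)}(h))$ for $j\le n$ and $0$ for $j\ge n+1$.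
   Formalization: The case q = 0 with g negative at all the points y_0(h),…,y_m(h) is excluded: there 0 is a fixed point of H_h, but the condition at j = 0 would require g(y_σ(0)(h)) ≥ 0, so the equivalence as stated fails. *)

theory Defs
  imports
    "HOL-Probability.Probability"
    "HOL-Computational_Algebra.Polynomial"
    "HOL-Combinatorics.Permutations"
    "Jordan_Normal_Form.Matrix"
begin

(* The second parameter is the variance, whereas normal_density takes the standard deviation.
   Only b > 0 is meaningful. *)
definition gaussian :: "real \<Rightarrow> real \<Rightarrow> real measure" where
  "gaussian a b = density lborel (\<lambda>x. ennreal (normal_density a (sqrt b) x))"

definition conv :: "(real \<Rightarrow> real) \<Rightarrow> real measure \<Rightarrow> real \<Rightarrow> real" where
  "conv f \<nu> x = (\<integral>z. f (x - z) \<partial>\<nu>)"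

definition continuation ::
  "real \<Rightarrow> real \<Rightarrow> real \<Rightarrow> (real \<Rightarrow> real) \<Rightarrow> real \<Rightarrow> real" where
  "continuation r \<mu> h f x = exp (- r * h) * conv f (gaussian (- \<mu> * h) h) x"

definition interpolant :: "nat \<Rightarrow> (nat \<Rightarrow> real) \<Rightarrow> (real \<Rightarrow> real) \<Rightarrow> real poly" where
  "interpolant m y f = (THE p. degree p \<le> m \<and> (\<forall>i\<in>{0..m}. poly p (y i) = f (y i)))"

lemma interpolant_ex1:
  fixes y :: "nat \<Rightarrow> real" and f :: "real \<Rightarrow> real"
  assumes "inj_on y {0..m}"
  shows "\<exists>!p. degree p \<le> m \<and> (\<forall>i\<in>{0..m}. poly p (y i) = f (y i))"
proof (rule ex_ex1I)
  show "\<exists>p. degree p \<le> m \<and> (\<forall>i\<in>{0..m}. poly p (y i) = f (y i))"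
    using assms
  proof (induction m)
    case 0
    show ?case by (rule exI[of _ "[:f (y 0):]"]) simp
  next
    case (Suc m)
    have "inj_on y {0..m}" by (rule inj_on_subset[OF Suc.prems]) auto
    with Suc.IH obtain p where p: "degree p \<le> m" "\<forall>i\<in>{0..m}. poly p (y i) = f (y i)"
      by blast
    define w where "w = (\<Prod>i\<in>{0..m}. [:- y i, 1:])"
    define c where "c = (f (y (Suc m)) - poly p (y (Suc m))) / poly w (y (Suc m))"
    have dw: "degree w \<le> Suc m"
      unfolding w_def using degree_prod_sum_le[of "{0..m}" "\<lambda>i. [:- y i, 1:]"] by simp
    have w0: "poly w (y i) = 0" if "i \<in> {0..m}" for i
      using that unfolding w_def poly_prod by (intro prod_zero) auto
    have "y (Suc m) \<noteq> y i" if "i \<in> {0..m}" for i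
      using inj_onD[OF Suc.prems, of "Suc m" i] that by auto
    then have w1: "poly w (y (Suc m)) \<noteq> 0"
      unfolding w_def poly_prod by auto
    have "degree (p + Polynomial.smult c w) \<le> Suc m"
      using p(1) dw by (intro degree_add_le) (auto intro: le_trans[OF degree_smult_le])
    moreover have "poly (p + Polynomial.smult c w) (y i) = f (y i)" if "i \<in> {0..Suc m}" for i
    proof (cases "i = Suc m")
      case True
      then show ?thesis using w1 by (simp add: c_def)
    next
      case False
      then have "i \<in> {0..m}" using that by auto
      then show ?thesis using p(2) w0 by simp
    qed
    ultimately show ?case by blast
  qed
next
  fix p q
  assume p: "degree p \<le> m \<and> (\<forall>i\<in>{0..m}. poly p (y i) = f (y i))"
    and q: "degree q \<le> m \<and> (\<forall>i\<in>{0..m}. poly q (y i) = f (y i))"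
  show "p = q"
  proof (rule ccontr)
    assume "p \<noteq> q"
    then have nz: "p - q \<noteq> 0" by simp
    have "y ` {0..m} \<subseteq> {x. poly (p - q) x = 0}" using p q by auto
    then have "card (y ` {0..m}) \<le> card {x. poly (p - q) x = 0}"
      by (rule card_mono[OF poly_roots_finite[OF nz]])
    also have "\<dots> \<le> degree (p - q)" by (rule card_poly_roots_bound[OF nz])
    also have "\<dots> \<le> m" using p q by (intro degree_diff_le) auto
    finally show False using card_image[OF assms] by simp
  qed
qed

definition H_op ::
  "nat \<Rightarrow> real \<Rightarrow> real \<Rightarrow> (real \<Rightarrow> real) \<Rightarrow> real \<Rightarrow> (nat \<Rightarrow> real) \<Rightarrow> real poly \<Rightarrow> real poly" where
  "H_op m r \<mu> g h y p = interpolant m y (\<lambda>x. max (continuation r \<mu> h (poly p) x) (g x))"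

definition A_mat ::
  "nat \<Rightarrow> real \<Rightarrow> real \<Rightarrow> real \<Rightarrow> (nat \<Rightarrow> real) \<Rightarrow> nat \<Rightarrow> (nat \<Rightarrow> nat) \<Rightarrow> real mat" where
  "A_mat m r \<mu> h y n \<sigma> = mat (m + 1) (m + 1) (\<lambda>(j, k).
     if j \<le> n then y (\<sigma> j) ^ k
     else y (\<sigma> j) ^ k - continuation r \<mu> h (\<lambda>x. x ^ k) (y (\<sigma> j)))"

definition v_vec ::
  "nat \<Rightarrow> (real \<Rightarrow> real) \<Rightarrow> (nat \<Rightarrow> real) \<Rightarrow> nat \<Rightarrow> (nat \<Rightarrow> nat) \<Rightarrow> real Matrix.vec" where
  "v_vec m g y n \<sigma> = Matrix.vec (m + 1) (\<lambda>j. if j \<le> n then g (y (\<sigma> j)) else 0)"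

end

theory Submission
  imports Defs
begin

text \<open>
  Evaluating row \<open>j\<close> of the linear system at the coefficients of \<open>q\<close> gives the value of \<open>q\<close> at
  the node \<open>y (\<sigma> j)\<close> when \<open>j \<le> n\<close>, and the difference between that value and the continuation
  value when \<open>j > n\<close> (\<open>A_mat_mult_coeffs\<close>). So the linear system together with the two families
  of inequalities says that \<open>q\<close> agrees with the maximum of \<open>g\<close> and the continuation value at every
  node: \<open>\<sigma>\<close> lists first the nodes at which \<open>g\<close> realises the maximum, then nodes at which the
  continuation value does. By uniqueness of interpolation this agreement is the fixed point
  property (\<open>H_op_fixed_iff\<close>).

  What remains is that the first block of nodes always contains at least the index \<open>0\<close>, so for a
  fixed point the set of nodes at which \<open>g\<close> dominates must not be empty. If it were, \<open>q\<close> would agree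
  with its discounted Gaussian average at \<open>m + 1\<close> nodes. Averaging the translates of a polynomial
  gives a polynomial of the same degree with the same leading coefficient (\<open>conv_poly\<close>), so the
  two would agree identically, and comparing leading coefficients with a discount factor other
  than \<open>1\<close> forces \<open>q = 0\<close> (\<open>discounted_conv_fixed_zero\<close>). Then the continuation value vanishes,
  and the nonnegative value of \<open>g\<close> at some node contradicts the emptiness.
\<close>

section \<open>Averages of polynomials over a measure with finite moments\<close>

lemma integrable_poly:
  fixes \<nu> :: "real measure"
  assumes "\<And>k. integrable \<nu> (\<lambda>z. z ^ k)"
  shows "integrable \<nu> (poly p)"
proof -
  have "integrable \<nu> (\<lambda>z. \<Sum>k\<le>degree p. coeff p k * z ^ k)"
    using assms by (intro Bochner_Integration.integrable_sum integrable_mult_right) auto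
  then show ?thesis by (simp add: poly_altdef[abs_def])
qed

lemma integrable_poly_translate:
  fixes \<nu> :: "real measure"
  assumes "\<And>k. integrable \<nu> (\<lambda>z. z ^ k)"
  shows "integrable \<nu> (\<lambda>z. poly p (x - z))"
proof -
  have "integrable \<nu> (poly (pcompose p [:x, -1:]))"
    using assms by (rule integrable_poly)
  then show ?thesis by (simp add: poly_pcompose[abs_def])
qed

lemma conv_poly_eq_sum:
  fixes \<nu> :: "real measure"
  assumes "\<And>k. integrable \<nu> (\<lambda>z. z ^ k)" and "degree p \<le> m"
  shows "conv (poly p) \<nu> x = (\<Sum>k\<le>m. coeff p k * conv (\<lambda>t. t ^ k) \<nu> x)"
proof -
  have int: "integrable \<nu> (\<lambda>z. (x - z) ^ k)" for k
    using integrable_poly_translate[OF assms(1), of "monom 1 k" x] by (simp add: poly_monom)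
  have eq: "poly p t = (\<Sum>k\<le>m. coeff p k * t ^ k)" for t
    using assms(2) unfolding poly_altdef
    by (intro sum.mono_neutral_left) (auto simp: coeff_eq_0)
  show ?thesis
    unfolding conv_def eq using int
    by (subst Bochner_Integration.integral_sum) auto
qed

text \<open>Expanding \<open>(x - z) ^ k\<close> by the binomial theorem leaves the moments as coefficients; the term
  of degree \<open>k\<close> carries the moment of order zero, which is \<open>1\<close> for a probability measure.\<close>

lemma conv_power:
  fixes \<nu> :: "real measure"
  assumes "prob_space \<nu>" and mom: "\<And>k. integrable \<nu> (\<lambda>z. z ^ k)"
  shows "\<exists>P. degree P \<le> k \<and> coeff P k = 1 \<and> (\<forall>x. conv (\<lambda>t. t ^ k) \<nu> x = poly P x)"
proof -
  interpret prob_space \<nu> by fact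
  have int: "integrable \<nu> (\<lambda>z. (- z) ^ i)" for i
    using integrable_poly_translate[OF mom, of "monom 1 i" 0] by (simp add: poly_monom)
  define P where
    "P = (\<Sum>i\<le>k. monom (of_nat (k choose i) * (\<integral>z. (- z) ^ (k - i) \<partial>\<nu>)) i)"
  have "conv (\<lambda>t. t ^ k) \<nu> x = poly P x" for x
  proof -
    have "conv (\<lambda>t. t ^ k) \<nu> x =
        (\<integral>z. (\<Sum>i\<le>k. of_nat (k choose i) * x ^ i * (- z) ^ (k - i)) \<partial>\<nu>)"
      unfolding conv_def using binomial_ring[of x "- z" k for z] by simp
    also have "\<dots> = (\<Sum>i\<le>k. of_nat (k choose i) * x ^ i * (\<integral>z. (- z) ^ (k - i) \<partial>\<nu>))"
      using int by (subst Bochner_Integration.integral_sum) auto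
    also have "\<dots> = poly P x"
      by (simp add: P_def poly_sum poly_monom mult_ac)
    finally show ?thesis .
  qed
  moreover have "degree P \<le> k"
    unfolding P_def by (intro degree_sum_le) (auto intro: le_trans[OF degree_monom_le])
  moreover have "coeff P k = 1"
    by (simp add: P_def coeff_sum prob_space)
  ultimately show ?thesis by blast
qed

lemma conv_poly:
  fixes \<nu> :: "real measure"
  assumes "prob_space \<nu>" and mom: "\<And>k. integrable \<nu> (\<lambda>z. z ^ k)"
  obtains P where "degree P \<le> degree p" "coeff P (degree p) = lead_coeff p"
    "\<And>x. conv (poly p) \<nu> x = poly P x"
proof -
  obtain Q where Q: "\<And>k. degree (Q k) \<le> k" "\<And>k. coeff (Q k) k = 1"
    "\<And>k x. conv (\<lambda>t. t ^ k) \<nu> x = poly (Q k) x"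
    using conv_power[OF assms] by metis
  let ?d = "degree p"
  define P where "P = (\<Sum>k\<le>?d. Polynomial.smult (coeff p k) (Q k))"
  show ?thesis
  proof (rule that[of P])
    show "degree P \<le> ?d"
      unfolding P_def
      by (intro degree_sum_le) (auto intro: le_trans[OF degree_smult_le] le_trans[OF Q(1)])
    have "coeff P ?d = (\<Sum>k\<le>?d. coeff p k * coeff (Q k) ?d)"
      by (simp add: P_def coeff_sum)
    also have "\<dots> = (\<Sum>k\<in>{?d}. coeff p k * coeff (Q k) ?d)"
    proof (intro sum.mono_neutral_right ballI)
      fix k assume "k \<in> {..?d} - {?d}"
      then have "degree (Q k) < ?d" using Q(1)[of k] by auto
      then show "coeff p k * coeff (Q k) ?d = 0" by (simp add: coeff_eq_0)
    qed auto
    finally show "coeff P ?d = lead_coeff p" by (simp add: Q(2))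
    show "conv (poly p) \<nu> x = poly P x" for x
      by (simp add: conv_poly_eq_sum[OF mom order_refl] P_def poly_sum Q(3))
  qed
qed

text \<open>Agreement at more points than the degree is agreement of polynomials, and then averaging
  preserves the leading coefficient while discounting scales it by \<open>c\<close>.\<close>

lemma discounted_conv_fixed_zero:
  fixes \<nu> :: "real measure" and c :: real
  assumes "prob_space \<nu>" and "\<And>k. integrable \<nu> (\<lambda>z. z ^ k)"
    and "c \<noteq> 1" and "degree p < card S"
    and fixed: "\<And>x. x \<in> S \<Longrightarrow> poly p x = c * conv (poly p) \<nu> x"
  shows "p = 0"
proof -
  obtain P where P: "degree P \<le> degree p" "coeff P (degree p) = lead_coeff p"
    "\<And>x. conv (poly p) \<nu> x = poly P x"
    using conv_poly[OF assms(1,2), of p] by metis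
  have "p = Polynomial.smult c P"
  proof (rule poly_eqI_degree[of S])
    show "poly p x = poly (Polynomial.smult c P) x" if "x \<in> S" for x
      using fixed[OF that] P(3) by simp
    show "degree p < card S" by fact
    show "degree (Polynomial.smult c P) < card S"
      using degree_smult_le[of c P] P(1) assms(4) by linarith
  qed
  then have "lead_coeff p = c * lead_coeff p"
    by (metis P(2) coeff_smult)
  then show ?thesis using \<open>c \<noteq> 1\<close> by simp
qed

section \<open>The Gaussian measure\<close>

lemma prob_space_gaussian: "b > 0 \<Longrightarrow> prob_space (gaussian a b)"
  unfolding gaussian_def by (intro prob_space_normal_density) simp

lemma gaussian_moments:
  assumes "b > 0"
  shows "integrable (gaussian a b) (\<lambda>z. z ^ k)"
proof -
  have centred: "integrable (gaussian a b) (\<lambda>z. (z - a) ^ i)" for i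
    unfolding gaussian_def using integrable_normal_moment[of "sqrt b" a i] assms
    by (subst integrable_density) (auto simp: normal_density_nonneg)
  \<comment> \<open>Powers of \<open>z\<close> are combinations of powers of \<open>z - a\<close>, so the centred moments suffice.\<close>
  have "z ^ k = (\<Sum>i\<le>k. of_nat (k choose i) * (z - a) ^ i * a ^ (k - i))" for z
    using binomial_ring[of "z - a" a k] by simp
  then show ?thesis using centred
    by (auto intro!: Bochner_Integration.integrable_sum)
qed

section \<open>Fixed points and the linear system\<close>

lemma H_op_fixed_iff:
  assumes "inj_on y {0..m}" and "degree q \<le> m"
  shows "H_op m r \<mu> g h y q = q \<longleftrightarrow>
    (\<forall>i\<in>{0..m}. poly q (y i) = max (g (y i)) (continuation r \<mu> h (poly q) (y i)))"
proof -
  let ?f = "\<lambda>x. max (continuation r \<mu> h (poly q) x) (g x)"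
  let ?I = "\<lambda>p. degree p \<le> m \<and> (\<forall>i\<in>{0..m}. poly p (y i) = ?f (y i))"
  have ex1: "\<exists>!p. ?I p" by (rule interpolant_ex1[OF assms(1)])
  have "(THE p. ?I p) = q \<longleftrightarrow> ?I q"
  proof
    show "?I q" if "(THE p. ?I p) = q" using theI'[OF ex1] unfolding that .
    show "(THE p. ?I p) = q" if "?I q" using ex1 that by (rule the1_equality)
  qed
  then show ?thesis
    using assms(2) by (simp add: H_op_def interpolant_def max.commute)
qed

text \<open>The entries in a row are the values of the monomials, or of the monomials minus their
  continuation values, at one node. Both operations are linear in the function; for the second
  this uses that the Gaussian moments are finite.\<close>

lemma A_mat_mult_coeffs:
  assumes "h > 0" and "degree q \<le> m"
  shows "A_mat m r \<mu> h y n \<sigma> *\<^sub>v Matrix.vec (m + 1) (coeff q) =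
    Matrix.vec (m + 1) (\<lambda>j. if j \<le> n then poly q (y (\<sigma> j))
      else poly q (y (\<sigma> j)) - continuation r \<mu> h (poly q) (y (\<sigma> j)))"
proof (rule eq_vecI)
  fix j
  assume "j < dim_vec (Matrix.vec (m + 1) (\<lambda>j. if j \<le> n then poly q (y (\<sigma> j))
      else poly q (y (\<sigma> j)) - continuation r \<mu> h (poly q) (y (\<sigma> j))))"
  then have j: "j < m + 1" by simp
  let ?x = "y (\<sigma> j)"
  let ?c = "continuation r \<mu> h"
  have row: "(A_mat m r \<mu> h y n \<sigma> *\<^sub>v Matrix.vec (m + 1) (coeff q)) $ j =
      (\<Sum>k\<le>m. (if j \<le> n then ?x ^ k else ?x ^ k - ?c (\<lambda>t. t ^ k) ?x) * coeff q k)"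
    using j by (simp add: A_mat_def mult_mat_vec_def scalar_prod_def
        atLeast0LessThan lessThan_Suc_atMost del: sum.lessThan_Suc)
  have value_q: "poly q ?x = (\<Sum>k\<le>m. ?x ^ k * coeff q k)"
    using assms(2) unfolding poly_altdef
    by (subst mult.commute) (intro sum.mono_neutral_left, auto simp: coeff_eq_0)
  have cont_q: "?c (poly q) ?x = (\<Sum>k\<le>m. ?c (\<lambda>t. t ^ k) ?x * coeff q k)"
    unfolding continuation_def conv_poly_eq_sum[OF gaussian_moments[OF assms(1)] assms(2)]
    by (simp add: sum_distrib_left mult_ac)
  show "(A_mat m r \<mu> h y n \<sigma> *\<^sub>v Matrix.vec (m + 1) (coeff q)) $ j =
    Matrix.vec (m + 1) (\<lambda>j. if j \<le> n then poly q (y (\<sigma> j))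
      else poly q (y (\<sigma> j)) - continuation r \<mu> h (poly q) (y (\<sigma> j))) $ j"
    using j unfolding row
    by (simp add: value_q cont_q left_diff_distrib sum_subtractf)
qed (simp add: A_mat_def)

lemma linear_system_iff:
  assumes "h > 0" and "degree q \<le> m"
  shows "A_mat m r \<mu> h y n \<sigma> *\<^sub>v Matrix.vec (m + 1) (coeff q) = v_vec m g y n \<sigma> \<longleftrightarrow>
    (\<forall>j\<in>{0..m}. poly q (y (\<sigma> j)) =
       (if j \<le> n then g (y (\<sigma> j)) else continuation r \<mu> h (poly q) (y (\<sigma> j))))"
  unfolding A_mat_mult_coeffs[OF assms] v_vec_def
  by (auto simp: vec_eq_iff split: if_splits)

text \<open>The permutation is glued from two bijections between sets of equal size. The set \<open>S\<close> has to be
  nonempty because \<open>{0..n}\<close> has \<open>n + 1\<close> elements, at least one.\<close>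

lemma permutation_onto_initial_segment:
  assumes "S \<subseteq> {0..m::nat}" and "S \<noteq> {}"
  obtains n \<sigma> where "n \<le> m" "\<sigma> permutes {0..m}" "\<sigma> ` {0..n} = S"
    "\<sigma> ` {n + 1..m} = {0..m} - S"
proof -
  have fin: "finite S" using assms(1) finite_subset by blast
  define n where "n = card S - 1"
  have "card S > 0" using fin assms(2) by (simp add: card_gt_0_iff)
  then have n: "card S = n + 1" by (simp add: n_def)
  have "card S \<le> m + 1" using card_mono[OF _ assms(1)] by simp
  then have "n \<le> m" using n by simp
  obtain f where f: "bij_betw f {0..n} S"
    using finite_same_card_bij[of "{0..n}" S] fin n by auto
  have "card ({0..m} - S) = m - n"
    using card_Diff_subset[OF fin assms(1)] n by simp
  then obtain f' where f': "bij_betw f' {n + 1..m} ({0..m} - S)"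
    using finite_same_card_bij[of "{n + 1..m}" "{0..m} - S"] by auto
  define \<sigma> where "\<sigma> j = (if j \<le> n then f j else if j \<le> m then f' j else j)" for j
  have b: "bij_betw \<sigma> {0..n} S"
    using f by (subst bij_betw_cong[of _ _ f]) (auto simp: \<sigma>_def)
  have b': "bij_betw \<sigma> {n + 1..m} ({0..m} - S)"
    using f' by (subst bij_betw_cong[of _ _ f']) (auto simp: \<sigma>_def)
  have "{0..n} \<union> {n + 1..m} = {0..m}" "S \<union> ({0..m} - S) = {0..m}"
    using \<open>n \<le> m\<close> assms(1) by auto
  with bij_betw_combine[OF b b'] have "bij_betw \<sigma> {0..m} {0..m}" by auto
  then have "\<sigma> permutes {0..m}"
    by (rule bij_imp_permutes) (use \<open>n \<le> m\<close> in \<open>auto simp: \<sigma>_def\<close>)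
  with \<open>n \<le> m\<close> b b' show ?thesis
    using that by (auto simp: bij_betw_def)
qed

text \<open>If \<open>g\<close> lay below the continuation value at every node, \<open>q\<close> would agree with its discounted
  average at \<open>m + 1\<close> nodes and hence be zero; this is what the nondegeneracy condition excludes.
  The conclusion supplies the index \<open>j = 0\<close>, which always belongs to the block \<open>j \<le> n\<close> of the
  linear system.\<close>

lemma stopping_node_exists:
  assumes "r > 0" and "h > 0" and "inj_on y {0..m}" and "degree q \<le> m"
    and nondegenerate: "q = 0 \<Longrightarrow> \<exists>i\<in>{0..m}. g (y i) \<ge> 0"
    and agree: "\<forall>i\<in>{0..m}. poly q (y i) = max (g (y i)) (continuation r \<mu> h (poly q) (y i))"
  shows "\<exists>i\<in>{0..m}. continuation r \<mu> h (poly q) (y i) \<le> g (y i)"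
proof (rule ccontr)
  assume none: "\<not> ?thesis"
  have lt: "g (y i) < continuation r \<mu> h (poly q) (y i)" if "i \<in> {0..m}" for i
    using none that by (meson not_le)
  have "q = 0"
  proof (rule discounted_conv_fixed_zero[of "gaussian (- \<mu> * h) h" "exp (- r * h)" q "y ` {0..m}"])
    show "exp (- r * h) \<noteq> 1" using \<open>r > 0\<close> \<open>h > 0\<close> by simp
    show "degree q < card (y ` {0..m})"
      using card_image[OF assms(3)] assms(4) by simp
    fix x assume "x \<in> y ` {0..m}"
    then show "poly q x = exp (- r * h) * conv (poly q) (gaussian (- \<mu> * h) h) x"
      using agree lt unfolding continuation_def[symmetric] by (force simp: max_absorb2 less_imp_le)
  qed (use prob_space_gaussian gaussian_moments \<open>h > 0\<close> in auto)
  then obtain i where "i \<in> {0..m}" "g (y i) \<ge> 0" using nondegenerate by blast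
  moreover have "continuation r \<mu> h (poly q) (y i) = 0"
    using \<open>q = 0\<close> by (simp add: continuation_def conv_def)
  ultimately show False using lt[of i] by simp
qed

theorem lemmaB3:
  fixes m :: nat and r \<mu> h :: real and g :: "real \<Rightarrow> real"
    and y :: "nat \<Rightarrow> real" and q :: "real poly"
  assumes "m > 0" and "r > 0" and "\<mu> = 1 / 2 - r"
    and "continuous_on UNIV g" and "h > 0"
    and "inj_on y {0..m}"
    and "degree q \<le> m"
    and nondegenerate: "q = 0 \<Longrightarrow> \<exists>i\<in>{0..m}. g (y i) \<ge> 0"
  shows "H_op m r \<mu> g h y q = q \<longleftrightarrow>
    (\<exists>n\<in>{0..m}. \<exists>\<sigma>. \<sigma> permutes {0..m} \<and>
       A_mat m r \<mu> h y n \<sigma> *\<^sub>v Matrix.vec (m + 1) (coeff q) = v_vec m g y n \<sigma> \<and>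
       (\<forall>j\<in>{0..n}. max (g (y (\<sigma> j))) (continuation r \<mu> h (poly q) (y (\<sigma> j)))
                     = g (y (\<sigma> j))) \<and>
       (\<forall>j\<in>{n + 1..m}. max (g (y (\<sigma> j))) (continuation r \<mu> h (poly q) (y (\<sigma> j)))
                         = continuation r \<mu> h (poly q) (y (\<sigma> j))))"
    (is "_ \<longleftrightarrow> ?R")
proof -
  let ?c = "\<lambda>i. continuation r \<mu> h (poly q) (y i)"
  let ?agree = "\<forall>i\<in>{0..m}. poly q (y i) = max (g (y i)) (?c i)"
  note system = linear_system_iff[OF \<open>h > 0\<close> \<open>degree q \<le> m\<close>]
  have "?agree \<longleftrightarrow> ?R"
  proof
    assume agree: ?agree
    define S where "S = {i \<in> {0..m}. ?c i \<le> g (y i)}"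
    have "S \<noteq> {}"
      using stopping_node_exists[OF assms(2,5,6,7) nondegenerate agree] by (auto simp: S_def)
    moreover have "S \<subseteq> {0..m}" by (auto simp: S_def)
    ultimately obtain n \<sigma> where n: "n \<le> m" and perm: "\<sigma> permutes {0..m}"
      and stop: "\<sigma> ` {0..n} = S" and cont: "\<sigma> ` {n + 1..m} = {0..m} - S"
      by (metis permutation_onto_initial_segment)
    have stop': "?c (\<sigma> j) \<le> g (y (\<sigma> j))" if "j \<in> {0..n}" for j
      using imageI[OF that, of \<sigma>] unfolding stop S_def by simp
    have cont': "g (y (\<sigma> j)) \<le> ?c (\<sigma> j)" if "j \<in> {n + 1..m}" for j
      using imageI[OF that, of \<sigma>] unfolding cont S_def by auto
    have "poly q (y (\<sigma> j)) = (if j \<le> n then g (y (\<sigma> j)) else ?c (\<sigma> j))" if "j \<in> {0..m}" for j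
    proof -
      have "\<sigma> j \<in> {0..m}" using that permutes_in_image[OF perm] by blast
      then have "poly q (y (\<sigma> j)) = max (g (y (\<sigma> j))) (?c (\<sigma> j))" using agree by blast
      then show ?thesis using stop'[of j] cont'[of j] that by auto
    qed
    then show ?R
      using n perm stop' cont' unfolding system
      by (intro bexI[of _ n] exI[of _ \<sigma>]) auto
  next
    assume ?R
    then obtain n \<sigma> where perm: "\<sigma> permutes {0..m}"
      and sys: "\<forall>j\<in>{0..m}. poly q (y (\<sigma> j)) = (if j \<le> n then g (y (\<sigma> j)) else ?c (\<sigma> j))"
      and stop: "\<forall>j\<in>{0..n}. max (g (y (\<sigma> j))) (?c (\<sigma> j)) = g (y (\<sigma> j))"
      and cont: "\<forall>j\<in>{n + 1..m}. max (g (y (\<sigma> j))) (?c (\<sigma> j)) = ?c (\<sigma> j)"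
      unfolding system by blast
    have "poly q (y (\<sigma> j)) = max (g (y (\<sigma> j))) (?c (\<sigma> j))" if "j \<in> {0..m}" for j
      using sys stop cont that by (cases "j \<le> n") auto
    then have "\<forall>i\<in>\<sigma> ` {0..m}. poly q (y i) = max (g (y i)) (?c i)" by blast
    then show ?agree unfolding permutes_image[OF perm] .
  qed
  then show ?thesis unfolding H_op_fixed_iff[OF assms(6,7)] .
qed

end
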